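(* Under the standing assumptions A1--A4 (see context), assume that $f$ is convex and that $(u_k)_{k\in\mathbb N}$ is generated by the proximal gradient algorithm (see context) with starting point $u_0\in\operatorname{dom}g$ and stepsize bounds $0<L_a\le L_b<\infty$. Let $M_0>0$ be such that $\|u\|_{\mathcal U}\le M_0$ for all $u\in\mathcal U$ with $J(u)\le J(u_0)$. Then $$r_J(u_k)\le\frac{r_J(u_0)}{1+qk}\qquad\forall k\in\mathbb N,$$ where $$q=\max\{q_1,q_2\},\quad q_1=\frac12\min\left\{1,\frac{r_J(u_0)}{4L_bM_0^2}\right\},\quad q_2=\frac{L_a\,r_J(u_0)}{8(L_b+L_{\nabla f})^2M_0^2}.$$ Moreover, $(u_k)_k$ admits at least one weak*-convergent subsequence, and every weak* accumulation point is a minimizer of $J$ over $\mathcal U$.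
   Context: Standing assumptions. (A1) $\mathcal U\cong Y^*$, where $Y$ is a separable Banach space with norm $\|\cdot\|_Y$; $\langle\cdot,\cdot\rangle$ is the pairing between $Y$ and $\mathcal U$, and $\mathcal U$ carries the dual norm $\|u\|_{\mathcal U}=\sup_{\|y\|_Y\le1}\langle y,u\rangle$. (A2) $g:\mathcal U\to[0,\infty]$ is proper, convex and sequentially weak* lower semicontinuous. (A3) $f:\mathcal U\to[0,\infty)$ is sequentially weak* lower semicontinuous on $\operatorname{dom}g$, and there are a neighborhood $\mathcal N$ of $\operatorname{dom}g$ in $\mathcal U$ and a map $\nabla f:\operatorname{dom}g\to Y$ such that $f$ is Gâteaux differentiable on $\mathcal N$ with $f'(u)(\delta u)=\langle\nabla f(u),\delta u\rangle$ for all $u\in\operatorname{dom}g$, $\delta u\in\mathcal U$; moreover there is $L_{\nabla f}\ge0$ with $\|\nabla f(u_1)-\nabla f(u_2)\|_Y\le L_{\nabla f}\|u_1-u_2\|_{\mathcal U}$ for all $u_1,u_2\in\operatorname{dom}g$. (A4) With $J:=f+g$: if $\|u_k\|_{\mathcal U}\to\infty$ then $J(u_k)\to\infty$ (so an $M_0$ as in the claim exists). The residual is $r_J(u):=J(u)-\min_{v\in\mathcal U}J(v)$ (a global minimizer exists under A1--A4). Algorithm. Fix $u_0\in\operatorname{dom}g$ and $0<L_a\le L_b<\infty$. Put $\mathcal Q_L(v,u):=f(u)+\langle\nabla f(u),v-u\rangle+g(v)+\frac L2\|v-u\|_{\mathcal U}^2$. For each $k\in\mathbb N=\{0,1,\dots\}$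 choose $u_{k+1}\in\operatorname{arg\,min}_{v\in\mathcal U}\mathcal Q_{L_k}(v,u_k)$, where $L_k$ is such that $L_k\in[L_a,L_b]$ and $J(u_{k+1})\le\mathcal Q_{L_k}(u_{k+1},u_k)$. *)

theory Defs
  imports "HOL-Analysis.Analysis"
begin

section \<open>The dual pairing and the weak* topology\<close>

text \<open>The type \<open>'y \<Rightarrow>\<^sub>L real\<close> with its operator norm is the dual of \<open>'y\<close>. A real normed space
  \<open>'u\<close> is identified with it through an isometric isomorphism \<open>\<Phi>\<close>, and the pairing of
  \<open>y\<close> and \<open>u\<close> is \<open>\<Phi> u\<close> evaluated at \<open>y\<close>.\<close>

definition isometric_dual_iso ::
    "('u::real_normed_vector \<Rightarrow> ('y::real_normed_vector \<Rightarrow>\<^sub>L real)) \<Rightarrow> bool" where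
  "isometric_dual_iso \<Phi> \<longleftrightarrow> linear \<Phi> \<and> bij \<Phi> \<and> (\<forall>u. norm (\<Phi> u) = norm u)"

definition pairing ::
    "('u \<Rightarrow> ('y::real_normed_vector \<Rightarrow>\<^sub>L real)) \<Rightarrow> 'y \<Rightarrow> 'u \<Rightarrow> real" where
  "pairing \<Phi> y u = blinfun_apply (\<Phi> u) y"

lemma norm_eq_SUP_pairing:
  assumes "isometric_dual_iso \<Phi>"
  shows "norm u = (SUP y\<in>cball 0 1. pairing \<Phi> y u)"
proof (rule antisym)
  have le: "pairing \<Phi> y u \<le> norm u" if "y \<in> cball 0 1" for y
  proof -
    have "pairing \<Phi> y u \<le> norm (\<Phi> u) * norm y"
      using norm_blinfun[of "\<Phi> u" y] by (simp add: pairing_def)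
    also have "\<dots> \<le> norm (\<Phi> u)"
      using that by (simp add: mult_left_le)
    finally show ?thesis
      using assms by (simp add: isometric_dual_iso_def)
  qed
  then show "(SUP y\<in>cball 0 1. pairing \<Phi> y u) \<le> norm u"
    by (intro cSUP_least) auto
  have bdd: "bdd_above ((\<lambda>y. pairing \<Phi> y u) ` cball 0 1)"
    using le by (intro bdd_aboveI2)
  define s where "s = (SUP y\<in>cball 0 1. pairing \<Phi> y u)"
  have s: "pairing \<Phi> y u \<le> s" if "norm y \<le> 1" for y
    unfolding s_def using that by (intro cSUP_upper bdd) auto
  have "0 \<le> s"
    using s[of 0] by (simp add: pairing_def)
  moreover have "norm (\<Phi> u y) \<le> s * norm y" for y
  proof (cases "y = 0")
    case False
    have "pairing \<Phi> (c *\<^sub>R (inverse (norm y) *\<^sub>R y)) u \<le> s" if "\<bar>c\<bar> = 1" for c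
      using that False by (intro s) (simp add: abs_mult)
    from this[of 1] this[of "-1"] show ?thesis
      using False by (simp add: pairing_def blinfun.scaleR_right blinfun.minus_right field_simps)
  qed simp
  ultimately have "norm (\<Phi> u) \<le> s"
    by (intro norm_blinfun_bound)
  then show "norm u \<le> (SUP y\<in>cball 0 1. pairing \<Phi> y u)"
    using assms by (simp add: isometric_dual_iso_def s_def)
qed

text \<open>The coarsest topology making every \<open>pairing \<Phi> y\<close> continuous: \<open>euclidean\<close> on the function
  type \<open>'y \<Rightarrow> real\<close> is the topology of pointwise convergence.\<close>

definition weak_star ::
    "('u \<Rightarrow> ('y::real_normed_vector \<Rightarrow>\<^sub>L real)) \<Rightarrow> 'u topology" where
  "weak_star \<Phi> = pullback_topology UNIV (\<lambda>u y. pairing \<Phi> y u) euclidean"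

lemma topspace_weak_star [simp]: "topspace (weak_star \<Phi>) = UNIV"
  by (simp add: weak_star_def topspace_pullback_topology)

lemma limitin_weak_star:
  "limitin (weak_star \<Phi>) x l F \<longleftrightarrow>
     (\<forall>y. ((\<lambda>n. pairing \<Phi> y (x n)) \<longlongrightarrow> pairing \<Phi> y l) F)"
proof -
  let ?p = "\<lambda>u y. pairing \<Phi> y u"
  have "limitin (weak_star \<Phi>) x l F \<longleftrightarrow> ((\<lambda>n. ?p (x n)) \<longlongrightarrow> ?p l) F"
    by (auto simp: limitin_def weak_star_def openin_pullback_topology topspace_pullback_topology
        tendsto_def)
  also have "\<dots> \<longleftrightarrow> (\<forall>y. ((\<lambda>n. ?p (x n) y) \<longlongrightarrow> ?p l y) F)"
    using limitin_componentwise
      [of "\<lambda>_. euclidean :: real topology" UNIV "\<lambda>n. ?p (x n)" "?p l" F]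
    by (simp add: euclidean_product_topology)
  finally show ?thesis .
qed

definition seq_accumulation_point :: "'a topology \<Rightarrow> (nat \<Rightarrow> 'a) \<Rightarrow> 'a \<Rightarrow> bool" where
  "seq_accumulation_point T x l \<longleftrightarrow> l \<in> topspace T \<and>
     (\<forall>V. openin T V \<and> l \<in> V \<longrightarrow> (\<exists>\<^sub>F n in sequentially. x n \<in> V))"

section \<open>Extended-real-valued functions\<close>

definition seq_lsc_on :: "'a topology \<Rightarrow> 'a set \<Rightarrow> ('a \<Rightarrow> ereal) \<Rightarrow> bool" where
  "seq_lsc_on T S F \<longleftrightarrow>
     (\<forall>x l. (\<forall>n. x n \<in> S) \<and> l \<in> S \<and> limitin T x l sequentially
        \<longrightarrow> F l \<le> liminf (\<lambda>n. F (x n)))"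

definition effective_domain :: "('a \<Rightarrow> ereal) \<Rightarrow> 'a set" where
  "effective_domain F = {u. F u < \<infinity>}"

definition proper_fun :: "('a \<Rightarrow> ereal) \<Rightarrow> bool" where
  "proper_fun F \<longleftrightarrow> (\<forall>u. F u \<noteq> -\<infinity>) \<and> effective_domain F \<noteq> {}"

definition convex_ereal :: "('a::real_vector \<Rightarrow> ereal) \<Rightarrow> bool" where
  "convex_ereal F \<longleftrightarrow>
     (\<forall>u v t. 0 < t \<and> t < 1 \<longrightarrow>
        F ((1 - t) *\<^sub>R u + t *\<^sub>R v) \<le> ereal (1 - t) * F u + ereal t * F v)"

section \<open>Gateaux derivatives\<close>

definition has_gateaux_derivative ::
    "('a::real_normed_vector \<Rightarrow> real) \<Rightarrow> ('a \<Rightarrow> real) \<Rightarrow> 'a \<Rightarrow> bool" where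
  "has_gateaux_derivative f D u \<longleftrightarrow>
     bounded_linear D \<and> (\<forall>d. ((\<lambda>t. (f (u + t *\<^sub>R d) - f u) / t) \<longlongrightarrow> D d) (at 0))"

definition gateaux_differentiable_on ::
    "('a::real_normed_vector \<Rightarrow> real) \<Rightarrow> 'a set \<Rightarrow> bool" where
  "gateaux_differentiable_on f S \<longleftrightarrow> (\<forall>u\<in>S. \<exists>D. has_gateaux_derivative f D u)"

section \<open>The composite problem and the proximal gradient algorithm\<close>

definition objective :: "('u \<Rightarrow> real) \<Rightarrow> ('u \<Rightarrow> ereal) \<Rightarrow> 'u \<Rightarrow> ereal" where
  "objective f g u = ereal (f u) + g u"

text \<open>\<open>LEAST m. m \<in> range J\<close> is the minimum of \<open>J\<close>; it is unspecified if \<open>J\<close> has no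
  minimizer.\<close>

definition residual :: "('u \<Rightarrow> ereal) \<Rightarrow> 'u \<Rightarrow> ereal" where
  "residual J u = J u - (LEAST m. m \<in> range J)"

definition prox_model ::
    "('u::real_normed_vector \<Rightarrow> ('y::real_normed_vector \<Rightarrow>\<^sub>L real)) \<Rightarrow> ('u \<Rightarrow> real) \<Rightarrow> ('u \<Rightarrow> 'y)
      \<Rightarrow> ('u \<Rightarrow> ereal) \<Rightarrow> real \<Rightarrow> 'u \<Rightarrow> 'u \<Rightarrow> ereal" where
  "prox_model \<Phi> f grad g L v u =
     ereal (f u + pairing \<Phi> (grad u) (v - u)) + g v + ereal (L / 2 * (norm (v - u))\<^sup>2)"

definition prox_grad_sequence ::
    "('u::real_normed_vector \<Rightarrow> ('y::real_normed_vector \<Rightarrow>\<^sub>L real)) \<Rightarrow> ('u \<Rightarrow> real) \<Rightarrow> ('u \<Rightarrow> 'y)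
      \<Rightarrow> ('u \<Rightarrow> ereal) \<Rightarrow> real \<Rightarrow> real \<Rightarrow> (nat \<Rightarrow> real) \<Rightarrow> (nat \<Rightarrow> 'u) \<Rightarrow> bool" where
  "prox_grad_sequence \<Phi> f grad g La Lb L u \<longleftrightarrow>
     u 0 \<in> effective_domain g \<and>
     (\<forall>k. is_arg_min (\<lambda>v. prox_model \<Phi> f grad g (L k) v (u k)) (\<lambda>v. v \<in> UNIV) (u (Suc k)) \<and>
          L k \<in> {La..Lb} \<and>
          objective f g (u (Suc k)) \<le> prox_model \<Phi> f grad g (L k) (u (Suc k)) (u k))"

end

theory Submission
  imports Defs
begin

text \<open>Write \<open>r k\<close> for the residual of the \<open>k\<close>-th iterate and \<open>p\<close> for a minimizer. The iterate
  \<open>u (Suc k)\<close> minimizes a model that majorizes the objective at \<open>u (Suc k)\<close>, so the objective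
  there is at most the model value at every point. Test points \<open>u k + t *\<^sub>R (p - u k)\<close> on the segment
  to the minimizer are the useful ones: by convexity all terms of the model except the proximal one
  lie below the chord of the objective, and the proximal term is at most \<open>Lb / 2 * t\<^sup>2 * (2 * M0)\<^sup>2\<close>
  as both endpoints lie in the sublevel set of \<open>u 0\<close>. With \<open>C = 4 * Lb * M0\<^sup>2\<close> this is
  \<open>r (Suc k) \<le> (1 - t) * r k + C / 2 * t\<^sup>2\<close> for all \<open>t\<close> in the unit interval
  (\<open>prox_grad_residual_step\<close>).

  Optimizing over \<open>t\<close> gives \<open>r k \<le> r 0 / (1 + k * r 0 / (2 * C))\<close> (\<open>sublinear_decay\<close>). The
  constant \<open>r 0 / (2 * C) = r 0 / (8 * Lb * M0\<^sup>2)\<close> dominates both \<open>q1\<close> and \<open>q2\<close>: the former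
  because the minimum is at most its second entry, the latter because \<open>La * Lb \<le> (Lb + Lf)\<^sup>2\<close>
  (\<open>rate_constants_le\<close>). One recursion therefore yields the bound for the larger of the two.

  The iterates are bounded, so the sequential Banach-Alaoglu theorem supplies weak* convergent
  subsequences. On bounded sets separability of the predual makes every topological accumulation
  point the limit of a subsequence; along it the objective tends to its minimum, and sequential
  lower semicontinuity shows that the limit is a minimizer. The same two ingredients, applied to a
  minimizing sequence, show that a minimizer exists.\<close>

section \<open>Sequential weak* compactness\<close>

lemma norm_pairing_le:
  assumes "isometric_dual_iso \<Phi>"
  shows "\<bar>pairing \<Phi> y v\<bar> \<le> norm v * norm y"
  using norm_blinfun[of "\<Phi> v" y] assms by (simp add: pairing_def isometric_dual_iso_def)

lemma separable_space_dense_sequence: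
  assumes "separable_space (euclidean :: 'a::topological_space topology)"
  obtains e :: "nat \<Rightarrow> 'a::topological_space" where "closure (range e) = UNIV"
proof -
  obtain C :: "'a set" where C: "countable C" "closure C = UNIV"
    using assms by (auto simp: separable_space_def)
  then have "C \<noteq> {}" by auto
  then show thesis
    using that[of "from_nat_into C"] C by (simp add: range_from_nat_into)
qed

text \<open>Uniformly bounded functionals are equi-Lipschitz, so the values at points of a dense set
  control the values everywhere up to a small error. This makes the values at every point a Cauchy
  sequence; the pointwise limit inherits linearity and the bound.\<close>

lemma bounded_functionals_converge_if_convergent_on_dense:
  fixes T :: "nat \<Rightarrow> 'y::real_normed_vector \<Rightarrow>\<^sub>L real"
  assumes dense: "closure D = UNIV"
    and bound: "\<And>n. norm (T n) \<le> B"
    and conv: "\<And>d. d \<in> D \<Longrightarrow> convergent (\<lambda>n. T n d)"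
  obtains S :: "'y \<Rightarrow>\<^sub>L real" where "\<And>y. (\<lambda>n. T n y) \<longlonglongrightarrow> S y"
proof -
  have "0 \<le> B" using bound[of 0] norm_ge_zero order_trans by blast
  have lip: "\<bar>T n y - T n d\<bar> \<le> B * norm (y - d)" for n y d
  proof -
    have "\<bar>T n (y - d)\<bar> \<le> norm (T n) * norm (y - d)"
      using norm_blinfun[of "T n" "y - d"] by simp
    also have "\<dots> \<le> B * norm (y - d)" by (intro mult_right_mono bound) simp
    finally show ?thesis by (simp add: blinfun.diff_right)
  qed
  have "Cauchy (\<lambda>n. T n y)" for y
  proof (rule metric_CauchyI)
    fix \<epsilon> :: real assume "0 < \<epsilon>"
    \<comment> \<open>The summand 1 keeps the radius meaningful when \<open>B\<close> is 0.\<close>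
    define \<delta> where "\<delta> = \<epsilon> / (4 * (B + 1))"
    have "\<delta> > 0" using \<open>0 < \<epsilon>\<close> \<open>0 \<le> B\<close> by (simp add: \<delta>_def)
    then obtain d where d: "d \<in> D" "dist d y < \<delta>"
      using dense closure_approachable[of y D] by auto
    have "B * norm (y - d) \<le> B * \<delta>"
      using d \<open>0 \<le> B\<close> by (intro mult_left_mono) (auto simp: dist_norm norm_minus_commute)
    also have "\<dots> \<le> \<epsilon> / 4"
      using \<open>0 < \<epsilon>\<close> \<open>0 \<le> B\<close> by (simp add: \<delta>_def field_simps)
    finally have close: "\<bar>T n y - T n d\<bar> \<le> \<epsilon> / 4" for n
      using lip[of n y d] by linarith
    have "Cauchy (\<lambda>n. T n d)" using conv[OF d(1)] by (rule convergent_Cauchy)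
    then obtain M where M: "\<And>m n. m \<ge> M \<Longrightarrow> n \<ge> M \<Longrightarrow> dist (T m d) (T n d) < \<epsilon> / 2"
      using metric_CauchyD[of "\<lambda>n. T n d" "\<epsilon> / 2"] \<open>0 < \<epsilon>\<close> by auto
    have "dist (T m y) (T n y) < \<epsilon>" if "m \<ge> M" "n \<ge> M" for m n
      using M[OF that] close[of m] close[of n] unfolding dist_real_def by linarith
    then show "\<exists>M. \<forall>m\<ge>M. \<forall>n\<ge>M. dist (T m y) (T n y) < \<epsilon>" by blast
  qed
  then have lim: "(\<lambda>n. T n y) \<longlonglongrightarrow> lim (\<lambda>n. T n y)" for y
    by (intro convergent_LIMSEQ_iff[THEN iffD1] Cauchy_convergent)
  define S where "S y = lim (\<lambda>n. T n y)" for y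
  have S: "(\<lambda>n. T n y) \<longlonglongrightarrow> S y" for y using lim by (simp add: S_def)
  have "bounded_linear S"
  proof (rule bounded_linear_intro)
    show "S (x + y) = S x + S y" for x y
      using LIMSEQ_unique[OF S[of "x + y"]] tendsto_add[OF S[of x] S[of y]]
      by (simp add: blinfun.add_right)
    show "S (r *\<^sub>R x) = r *\<^sub>R S x" for r x
      using LIMSEQ_unique[OF S[of "r *\<^sub>R x"]] tendsto_scaleR[OF tendsto_const S[of x]]
      by (simp add: blinfun.scaleR_right)
    have "norm (T n x) \<le> norm x * B" for n x
      using lip[of n x 0] by (simp add: blinfun.zero_right mult.commute)
    then show "norm (S x) \<le> norm x * B" for x
      by (intro LIMSEQ_le_const2[OF tendsto_norm[OF S]]) auto
  qed
  then show thesis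
    using that[of "Blinfun S"] S by (simp add: bounded_linear_Blinfun_apply)
qed

text \<open>The sequential Banach-Alaoglu theorem. The values at a dense sequence of points lie in a
  product of countably many compact intervals, which is metrizable and hence sequentially
  compact.\<close>

lemma bounded_sequence_has_weak_star_convergent_subsequence:
  fixes \<Phi> :: "'u::real_normed_vector \<Rightarrow> ('y::real_normed_vector \<Rightarrow>\<^sub>L real)"
  assumes sep: "separable_space (euclidean :: 'y topology)"
    and iso: "isometric_dual_iso \<Phi>"
    and bound: "\<And>n :: nat. norm (x n) \<le> B"
  obtains \<sigma> l where "strict_mono \<sigma>" "limitin (weak_star \<Phi>) (x \<circ> \<sigma>) l sequentially"
proof -
  obtain e :: "nat \<Rightarrow> 'y" where e: "closure (range e) = UNIV"
    using separable_space_dense_sequence[OF sep] by blast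
  define K where "K = PiE UNIV (\<lambda>i. {- (B * norm (e i))..B * norm (e i)})"
  have "compact K"
    using compactin_PiE[of "\<lambda>_. euclidean :: real topology" UNIV
        "\<lambda>i. {- (B * norm (e i))..B * norm (e i)}"]
    by (simp add: K_def euclidean_product_topology)
  moreover have "(\<lambda>i. pairing \<Phi> (e i) (x n)) \<in> K" for n
  proof -
    have "\<bar>pairing \<Phi> (e i) (x n)\<bar> \<le> B * norm (e i)" for i
      using norm_pairing_le[OF iso, of "e i" "x n"] mult_right_mono[OF bound[of n], of "norm (e i)"]
      by simp
    then show ?thesis by (auto simp: K_def abs_le_iff minus_le_iff)
  qed
  ultimately obtain c \<sigma> where \<sigma>: "strict_mono \<sigma>"
    and c: "((\<lambda>n i. pairing \<Phi> (e i) (x n)) \<circ> \<sigma>) \<longlonglongrightarrow> c"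
    unfolding compact_eq_seq_compact_metric seq_compact_def by meson
  have "(\<lambda>n. \<Phi> (x (\<sigma> n)) (e i)) \<longlonglongrightarrow> c i" for i
    using c limitin_componentwise[of "\<lambda>_. euclidean :: real topology" UNIV
        "(\<lambda>n i. pairing \<Phi> (e i) (x n)) \<circ> \<sigma>" c sequentially]
    by (simp add: euclidean_product_topology pairing_def)
  then have "convergent (\<lambda>n. \<Phi> (x (\<sigma> n)) d)" if "d \<in> range e" for d
    using that by (auto simp: convergent_def)
  moreover have "norm (\<Phi> (x (\<sigma> n))) \<le> B" for n
    using bound iso by (simp add: isometric_dual_iso_def)
  ultimately obtain S where S: "\<And>y. (\<lambda>n. \<Phi> (x (\<sigma> n)) y) \<longlonglongrightarrow> blinfun_apply S y"
    using bounded_functionals_converge_if_convergent_on_dense[OF e, of "\<lambda>n. \<Phi> (x (\<sigma> n))" B]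
    by metis
  obtain l where "\<Phi> l = S"
    using iso by (metis isometric_dual_iso_def bij_pointE)
  then have "limitin (weak_star \<Phi>) (x \<circ> \<sigma>) l sequentially"
    using S by (simp add: limitin_weak_star pairing_def)
  with \<sigma> that show thesis by blast
qed

text \<open>The weak* topology of the whole space is not first countable in general, so the boundedness
  of the sequence is essential. Controlling finitely many pairings with a dense sequence at a time
  gives a subsequence whose pairings with that dense sequence converge to those of \<open>l\<close>; any weak*
  limit of a further subsequence then agrees with \<open>l\<close> on a dense set and equals \<open>l\<close>.\<close>

lemma bounded_sequence_accumulation_point_is_subsequence_limit:
  fixes \<Phi> :: "'u::real_normed_vector \<Rightarrow> ('y::real_normed_vector \<Rightarrow>\<^sub>L real)"
  assumes sep: "separable_space (euclidean :: 'y topology)"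
    and iso: "isometric_dual_iso \<Phi>"
    and bound: "\<And>n. norm (x n) \<le> B"
    and acc: "seq_accumulation_point (weak_star \<Phi>) x l"
  obtains \<sigma> where "strict_mono \<sigma>" "limitin (weak_star \<Phi>) (x \<circ> \<sigma>) l sequentially"
proof -
  obtain e :: "nat \<Rightarrow> 'y" where e: "closure (range e) = UNIV"
    using separable_space_dense_sequence[OF sep] by blast
  define V where
    "V j = {v. \<forall>i\<le>j. dist (pairing \<Phi> (e i) v) (pairing \<Phi> (e i) l) < inverse (real (Suc j))}" for j
  have openV: "openin (weak_star \<Phi>) (V j)" for j
  proof -
    define W :: "('y \<Rightarrow> real) set" where
      "W = (\<Inter>i\<le>j. {\<phi>. dist (\<phi> (e i)) (pairing \<Phi> (e i) l) < inverse (real (Suc j))})"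
    have "open W"
      unfolding W_def by (intro open_INT ballI open_Collect_less continuous_intros) auto
    moreover have "V j = (\<lambda>v y. pairing \<Phi> y v) -` W \<inter> UNIV" by (auto simp: V_def W_def)
    ultimately show ?thesis
      unfolding weak_star_def openin_pullback_topology by auto
  qed
  have "l \<in> V j" for j by (simp add: V_def)
  then have freq: "\<exists>n>m. x n \<in> V j" for m j
    using acc openV unfolding seq_accumulation_point_def frequently_sequentially
    by (meson Suc_le_lessD)
  obtain \<rho> where \<rho>: "\<And>j. x (\<rho> j) \<in> V j" "\<And>j. \<rho> j < \<rho> (Suc j)"
    using dependent_nat_choice[of "\<lambda>j n. x n \<in> V j" "\<lambda>_ m n. m < n"] freq by metis
  have "strict_mono \<rho>" using \<rho>(2) by (simp add: strict_mono_Suc_iff)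
  have lim_e: "(\<lambda>j. pairing \<Phi> (e i) (x (\<rho> j))) \<longlonglongrightarrow> pairing \<Phi> (e i) l" for i
  proof (rule metric_tendsto_imp_tendsto[OF LIMSEQ_inverse_real_of_nat])
    show "\<forall>\<^sub>F j in sequentially.
        dist (pairing \<Phi> (e i) (x (\<rho> j))) (pairing \<Phi> (e i) l) \<le> dist (inverse (real (Suc j))) 0"
      using eventually_ge_at_top[of i]
      by eventually_elim (use \<rho>(1) in \<open>force simp: V_def\<close>)
  qed
  obtain \<tau> l' where \<tau>: "strict_mono \<tau>"
    and l': "limitin (weak_star \<Phi>) ((x \<circ> \<rho>) \<circ> \<tau>) l' sequentially"
    using bounded_sequence_has_weak_star_convergent_subsequence[OF sep iso, of "x \<circ> \<rho>" B] bound
    by auto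
  have "\<Phi> l' (e i) = \<Phi> l (e i)" for i
    using LIMSEQ_unique[OF _ LIMSEQ_subseq_LIMSEQ[OF lim_e[of i] \<tau>]] l'
    by (simp add: limitin_weak_star pairing_def o_def)
  then have "{y. \<Phi> l' y = \<Phi> l y} \<supseteq> range e" by auto
  moreover have "closed {y. \<Phi> l' y = \<Phi> l y}"
    by (intro closed_Collect_eq continuous_intros)
  ultimately have "{y. \<Phi> l' y = \<Phi> l y} = UNIV"
    using e closure_minimal by (metis UNIV_I subsetI subset_antisym)
  then have "\<Phi> l' = \<Phi> l" by (intro blinfun_eqI) auto
  then have "l' = l" using iso by (metis isometric_dual_iso_def bij_pointE)
  then show thesis
    using that[of "\<rho> \<circ> \<tau>"] l' \<tau> \<open>strict_mono \<rho>\<close> by (simp add: strict_mono_o o_assoc)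
qed

section \<open>Minimizers of the composite objective\<close>

lemma effective_domain_real:
  assumes "\<And>v. 0 \<le> g v" "v \<in> effective_domain g"
  shows "\<exists>a. g v = ereal a"
  using assms(2) assms(1)[of v] by (cases "g v") (auto simp: effective_domain_def)

text \<open>Lower semicontinuity of \<open>f\<close> is only known on the domain of \<open>g\<close>. A bound on the objective
  along the sequence bounds \<open>g\<close> as \<open>f\<close> is nonnegative, and lower semicontinuity of \<open>g\<close> then puts
  the limit in the domain of \<open>g\<close>.\<close>

lemma objective_limit_le:
  fixes f :: "'a \<Rightarrow> real"
  assumes g_nonneg: "\<And>v. 0 \<le> g v" and f_nonneg: "\<And>v. 0 \<le> f v"
    and g_lsc: "seq_lsc_on T UNIV g"
    and f_lsc: "seq_lsc_on T (effective_domain g) (\<lambda>v. ereal (f v))"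
    and bound: "\<And>n. objective f g (x n) \<le> ereal c"
    and lim: "limitin T x l sequentially"
    and J_lim: "(\<lambda>n. objective f g (x n)) \<longlonglongrightarrow> m"
  shows "objective f g l \<le> m"
proof -
  have g_bound: "g (x n) \<le> ereal c" for n
  proof -
    have "0 + g (x n) \<le> ereal (f (x n)) + g (x n)" using f_nonneg by (intro add_right_mono) simp
    then show ?thesis using bound[of n] by (simp add: objective_def)
  qed
  then have x_dom: "x n \<in> effective_domain g" for n
    using g_bound[of n] by (cases "g (x n)") (auto simp: effective_domain_def)
  have gl: "g l \<le> liminf (\<lambda>n. g (x n))"
    using g_lsc lim by (auto simp: seq_lsc_on_def)
  have "liminf (\<lambda>n. g (x n)) \<le> liminf (\<lambda>n. ereal c)"
    using g_bound by (intro Liminf_mono) auto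
  then have "liminf (\<lambda>n. g (x n)) \<le> ereal c" by (simp add: Liminf_const)
  with gl have "g l \<le> ereal c" by (rule order_trans)
  then have "l \<in> effective_domain g"
    using le_less_trans by (auto simp: effective_domain_def)
  then have fl: "ereal (f l) \<le> liminf (\<lambda>n. ereal (f (x n)))"
    using f_lsc lim x_dom by (auto simp: seq_lsc_on_def)
  have nonneg: "0 \<le> liminf (\<lambda>n. ereal (f (x n)))" "0 \<le> liminf (\<lambda>n. g (x n))"
    using f_nonneg g_nonneg by (auto intro!: Liminf_bounded)
  have "objective f g l \<le> liminf (\<lambda>n. ereal (f (x n))) + liminf (\<lambda>n. g (x n))"
    unfolding objective_def using fl gl by (rule add_mono)
  also have "\<dots> \<le> liminf (\<lambda>n. objective f g (x n))"
    unfolding objective_def using nonneg by (intro ereal_liminf_add_mono) auto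
  also have "\<dots> = m" using J_lim by (intro lim_imp_Liminf) auto
  finally show ?thesis .
qed

lemma objective_has_minimizer:
  fixes \<Phi> :: "'u::real_normed_vector \<Rightarrow> ('y::real_normed_vector \<Rightarrow>\<^sub>L real)"
  assumes sep: "separable_space (euclidean :: 'y topology)"
    and iso: "isometric_dual_iso \<Phi>"
    and g_nonneg: "\<And>v. 0 \<le> g v" and f_nonneg: "\<And>v. 0 \<le> f v"
    and g_lsc: "seq_lsc_on (weak_star \<Phi>) UNIV g"
    and f_lsc: "seq_lsc_on (weak_star \<Phi>) (effective_domain g) (\<lambda>v. ereal (f v))"
    and start: "objective f g w = ereal c"
    and sublevel: "\<And>v. objective f g v \<le> ereal c \<Longrightarrow> norm v \<le> B"
  obtains p where "\<And>v. objective f g p \<le> objective f g v"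
proof -
  let ?J = "objective f g"
  define A where "A = ?J ` {v. ?J v \<le> ereal c}"
  have "A \<noteq> {}" using start by (auto simp: A_def intro!: exI[of _ w])
  then obtain a where "\<And>n. a n \<in> A" and a: "a \<longlonglongrightarrow> Inf A"
    using Inf_as_limit by blast
  then have "\<forall>n. \<exists>v. a n = ?J v \<and> ?J v \<le> ereal c" by (auto simp: A_def)
  then obtain x where x: "\<And>n. a n = ?J (x n)" "\<And>n. ?J (x n) \<le> ereal c" by metis
  obtain \<sigma> p where \<sigma>: "strict_mono \<sigma>"
    and p: "limitin (weak_star \<Phi>) (x \<circ> \<sigma>) p sequentially"
    using bounded_sequence_has_weak_star_convergent_subsequence[OF sep iso, of x B] x(2) sublevel
    by metis
  have "(\<lambda>n. ?J ((x \<circ> \<sigma>) n)) \<longlonglongrightarrow> Inf A"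
    using LIMSEQ_subseq_LIMSEQ[OF a \<sigma>] x(1) by (simp add: o_def)
  then have p_le: "?J p \<le> Inf A"
    using objective_limit_le[OF g_nonneg f_nonneg g_lsc f_lsc _ p] x(2) by auto
  have "?J p \<le> ?J v" for v
  proof (cases "?J v \<le> ereal c")
    case True
    then have "Inf A \<le> ?J v" by (intro Inf_lower) (auto simp: A_def)
    with p_le show ?thesis by (rule order_trans)
  next
    case False
    have "Inf A \<le> ?J w" using start by (intro Inf_lower) (auto simp: A_def intro!: image_eqI[of _ _ w])
    with p_le start False show ?thesis by auto
  qed
  then show thesis using that by blast
qed

lemma residual_eq_diff_minimum:
  assumes "\<And>v. J p \<le> J v"
  shows "residual J v = J v - J p"
proof -
  have "(LEAST m. m \<in> range J) = J p" using assms by (intro Least_equality) auto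
  then show ?thesis by (simp add: residual_def)
qed

section \<open>Decrease of the objective in one step\<close>

lemma convex_gateaux_gradient_inequality:
  assumes conv: "convex_on UNIV f" and deriv: "has_gateaux_derivative f D w"
  shows "D (v - w) \<le> f v - f w"
proof (rule tendsto_upperbound)
  show "((\<lambda>t. (f (w + t *\<^sub>R (v - w)) - f w) / t) \<longlongrightarrow> D (v - w)) (at_right 0)"
    using deriv unfolding has_gateaux_derivative_def
    by (meson filterlim_at_split)
  have "(f (w + t *\<^sub>R (v - w)) - f w) / t \<le> f v - f w" if "0 < t" "t < 1" for t
  proof -
    have "f (w + t *\<^sub>R (v - w)) = f ((1 - t) *\<^sub>R w + t *\<^sub>R v)"
      by (simp add: algebra_simps)
    also have "\<dots> \<le> (1 - t) * f w + t * f v"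
      using conv that by (intro convex_onD) auto
    finally show ?thesis using that by (simp add: field_simps)
  qed
  then show "\<forall>\<^sub>F t in at_right 0. (f (w + t *\<^sub>R (v - w)) - f w) / t \<le> f v - f w"
    by (auto intro: eventually_at_rightI[of 0 1])
qed simp

lemma convex_ereal_le_real:
  assumes "convex_ereal g" "g w = ereal a" "g v = ereal b" "0 \<le> t" "t \<le> 1"
  shows "g (w + t *\<^sub>R (v - w)) \<le> ereal ((1 - t) * a + t * b)"
proof (cases "t = 0 \<or> t = 1")
  case False
  then have "g ((1 - t) *\<^sub>R w + t *\<^sub>R v) \<le> ereal (1 - t) * g w + ereal t * g v"
    using assms(1,4,5) by (simp add: convex_ereal_def)
  then show ?thesis using assms by (simp add: algebra_simps)
qed (use assms in auto)

text \<open>Convexity bounds the linearization of \<open>f\<close> and the value of \<open>g\<close> on the segment from \<open>w\<close> to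
  \<open>v\<close> by the chords, so only the proximal term exceeds the chord of the objective.\<close>

lemma prox_model_on_segment_le:
  assumes f_convex: "convex_on UNIV f" and g_convex: "convex_ereal g"
    and deriv: "has_gateaux_derivative f (\<lambda>d. pairing \<Phi> (grad w) d) w"
    and gw: "g w = ereal a" and gv: "g v = ereal b"
    and t: "0 \<le> t" "t \<le> 1"
  shows "prox_model \<Phi> f grad g \<mu> (w + t *\<^sub>R (v - w)) w
    \<le> ereal ((1 - t) * (f w + a) + t * (f v + b) + \<mu> / 2 * t\<^sup>2 * (norm (v - w))\<^sup>2)"
proof -
  have "bounded_linear (\<lambda>d. pairing \<Phi> (grad w) d)"
    using deriv by (simp add: has_gateaux_derivative_def)
  then have "pairing \<Phi> (grad w) (t *\<^sub>R (v - w)) = t * pairing \<Phi> (grad w) (v - w)"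
    using linear_simps(5) by fastforce
  also have "\<dots> \<le> t * (f v - f w)"
    using convex_gateaux_gradient_inequality[OF f_convex deriv] t by (intro mult_left_mono) auto
  finally have lin: "f w + pairing \<Phi> (grad w) (t *\<^sub>R (v - w)) \<le> (1 - t) * f w + t * f v"
    by (simp add: algebra_simps)
  have "prox_model \<Phi> f grad g \<mu> (w + t *\<^sub>R (v - w)) w
    = ereal (f w + pairing \<Phi> (grad w) (t *\<^sub>R (v - w))) + g (w + t *\<^sub>R (v - w))
      + ereal (\<mu> / 2 * (t\<^sup>2 * (norm (v - w))\<^sup>2))"
    using t by (simp add: prox_model_def power_mult_distrib)
  also have "\<dots> \<le> ereal ((1 - t) * f w + t * f v) + ereal ((1 - t) * a + t * b)
      + ereal (\<mu> / 2 * (t\<^sup>2 * (norm (v - w))\<^sup>2))"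
    using lin convex_ereal_le_real[OF g_convex gw gv t] by (intro add_mono) auto
  finally show ?thesis by (simp add: algebra_simps)
qed

section \<open>The sublinear rate\<close>

text \<open>If \<open>r k \<le> C\<close>, the choice \<open>t = r k / C\<close> gives
  \<open>r (Suc k) \<le> r k - (r k)\<^sup>2 / (2 * C)\<close>, hence
  \<open>1 / r (Suc k) \<ge> 1 / r k + 1 / (2 * C)\<close> for positive values. If \<open>r k > C\<close>, the choice \<open>t = 1\<close> gives
  \<open>r (Suc k) \<le> C / 2\<close>, while the bound at \<open>k\<close> forces \<open>k\<close> to be so small that
  the bound at \<open>Suc k\<close> is larger than \<open>C / 2\<close>.\<close>

lemma sublinear_decay:
  fixes r :: "nat \<Rightarrow> real"
  assumes C: "0 < C" and nonneg: "\<And>k. 0 \<le> r k"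
    and step: "\<And>k t. 0 \<le> t \<Longrightarrow> t \<le> 1 \<Longrightarrow> r (Suc k) \<le> (1 - t) * r k + C / 2 * t\<^sup>2"
  shows "r k * (2 * C + k * r 0) \<le> 2 * C * r 0"
proof (induction k)
  case (Suc k)
  have r0: "0 \<le> r 0" by (rule nonneg)
  show ?case
  proof (cases "r k \<le> C")
    case True
    have "r (Suc k) \<le> (1 - r k / C) * r k + C / 2 * (r k / C)\<^sup>2"
      using True C nonneg[of k] by (intro step) auto
    also have "\<dots> = r k * (1 - r k / (2 * C))"
      using C by (simp add: field_simps power2_eq_square)
    finally have dec: "r (Suc k) \<le> r k * (1 - r k / (2 * C))" .
    have "r (Suc k) * (2 * C + r k) \<le> r k * (1 - r k / (2 * C)) * (2 * C + r k)"
      using dec C nonneg[of k] by (intro mult_right_mono) auto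
    also have "\<dots> = 2 * C * r k - r k ^ 3 / (2 * C)"
      using C by (simp add: field_simps power2_eq_square power3_eq_cube)
    also have "\<dots> \<le> 2 * C * r k" using C nonneg[of k] by simp
    finally have implicit: "r (Suc k) * (2 * C + r k) \<le> 2 * C * r k" .
    show ?thesis
    proof (cases "r k = 0")
      case True
      then show ?thesis using dec C r0 nonneg[of "Suc k"] by simp
    next
      case False
      have "(r (Suc k) * (2 * C + Suc k * r 0)) * r k
          = r (Suc k) * (r k * (2 * C + k * r 0) + r 0 * r k)"
        by (simp add: algebra_simps)
      also have "\<dots> \<le> r (Suc k) * (2 * C * r 0 + r 0 * r k)"
        using Suc.IH nonneg[of "Suc k"] by (intro mult_left_mono) auto
      also have "\<dots> = r 0 * (r (Suc k) * (2 * C + r k))" by (simp add: algebra_simps)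
      also have "\<dots> \<le> r 0 * (2 * C * r k)" using implicit r0 by (intro mult_left_mono)
      finally have "(r (Suc k) * (2 * C + Suc k * r 0)) * r k \<le> (2 * C * r 0) * r k"
        by (simp add: mult_ac)
      then show ?thesis using False nonneg[of k] by (simp only: mult_le_cancel_right)
    qed
  next
    case False
    have "C * (2 * C + k * r 0) \<le> r k * (2 * C + k * r 0)"
      using False C r0 by (intro mult_right_mono) auto
    also have "\<dots> \<le> C * (2 * r 0)" using Suc.IH by simp
    finally have small: "2 * C + k * r 0 \<le> 2 * r 0" using C by simp
    have "r (Suc k) \<le> C / 2" using step[of 1 k] by simp
    then have "r (Suc k) * (2 * C + Suc k * r 0) \<le> C / 2 * (3 * r 0)"
      using small C r0 by (intro mult_mono) (auto simp: algebra_simps)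
    also have "\<dots> \<le> 2 * C * r 0" using C r0 by (simp add: mult_right_mono)
    finally show ?thesis .
  qed
qed simp

text \<open>Testing the model at \<open>w + t *\<^sub>R (p - w)\<close> with the current iterate \<open>w\<close> and a minimizer
  \<open>p\<close>, where both lie in the ball of radius \<open>M0\<close>, gives the hypothesis of \<open>sublinear_decay\<close>
  with \<open>C = 4 * Lb * M0\<^sup>2\<close>.\<close>

lemma prox_grad_residual_step:
  assumes f_convex: "convex_on UNIV f" and g_convex: "convex_ereal g"
    and deriv: "has_gateaux_derivative f (\<lambda>d. pairing \<Phi> (grad w) d) w"
    and gw: "g w = ereal a" and gp: "g p = ereal b"
    and norms: "norm w \<le> M0" "norm p \<le> M0"
    and \<mu>: "0 \<le> \<mu>" "\<mu> \<le> Lb"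
    and argmin: "\<And>v. prox_model \<Phi> f grad g \<mu> w' w \<le> prox_model \<Phi> f grad g \<mu> v w"
    and descent: "objective f g w' \<le> prox_model \<Phi> f grad g \<mu> w' w"
    and t: "0 \<le> t" "t \<le> 1"
  shows "objective f g w' \<le> ereal ((1 - t) * (f w + a) + t * (f p + b) + 4 * Lb * M0\<^sup>2 / 2 * t\<^sup>2)"
proof -
  have "norm (p - w) \<le> 2 * M0" using norms norm_triangle_ineq4[of p w] by linarith
  then have "(norm (p - w))\<^sup>2 \<le> (2 * M0)\<^sup>2" by (intro power_mono) auto
  then have "\<mu> / 2 * t\<^sup>2 * (norm (p - w))\<^sup>2 \<le> Lb / 2 * t\<^sup>2 * (2 * M0)\<^sup>2"
    using \<mu> by (intro mult_mono) auto
  also have "\<dots> = 4 * Lb * M0\<^sup>2 / 2 * t\<^sup>2" by (simp add: power_mult_distrib)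
  finally have prox: "\<mu> / 2 * t\<^sup>2 * (norm (p - w))\<^sup>2 \<le> 4 * Lb * M0\<^sup>2 / 2 * t\<^sup>2" .
  note descent
  also have "prox_model \<Phi> f grad g \<mu> w' w
      \<le> prox_model \<Phi> f grad g \<mu> (w + t *\<^sub>R (p - w)) w"
    by (rule argmin)
  also have "\<dots> \<le> ereal ((1 - t) * (f w + a) + t * (f p + b) + \<mu> / 2 * t\<^sup>2 * (norm (p - w))\<^sup>2)"
    using f_convex g_convex deriv gw gp t by (rule prox_model_on_segment_le)
  also have "\<dots> \<le> ereal ((1 - t) * (f w + a) + t * (f p + b) + 4 * Lb * M0\<^sup>2 / 2 * t\<^sup>2)"
    using prox by simp
  finally show ?thesis .
qed

lemma rate_constants_le:
  fixes r0 M0 La Lb Lf :: real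
  assumes "0 \<le> r0" "0 < M0" "0 < La" "La \<le> Lb" "0 \<le> Lf"
  shows "max (1 / 2 * min 1 (r0 / (4 * Lb * M0\<^sup>2))) (La * r0 / (8 * (Lb + Lf)\<^sup>2 * M0\<^sup>2))
    \<le> r0 / (8 * Lb * M0\<^sup>2)"
proof (rule max.boundedI)
  have "1 / 2 * min 1 (r0 / (4 * Lb * M0\<^sup>2)) \<le> 1 / 2 * (r0 / (4 * Lb * M0\<^sup>2))" by simp
  then show "1 / 2 * min 1 (r0 / (4 * Lb * M0\<^sup>2)) \<le> r0 / (8 * Lb * M0\<^sup>2)" by simp
  have "La * Lb \<le> Lb\<^sup>2" using assms by (simp add: power2_eq_square)
  also have "\<dots> \<le> (Lb + Lf)\<^sup>2" using assms by (intro power_mono) auto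
  finally have "La / (Lb + Lf)\<^sup>2 \<le> 1 / Lb" using assms by (simp add: field_simps)
  then have "La / (Lb + Lf)\<^sup>2 * (r0 / (8 * M0\<^sup>2)) \<le> 1 / Lb * (r0 / (8 * M0\<^sup>2))"
    using assms by (intro mult_right_mono) auto
  then show "La * r0 / (8 * (Lb + Lf)\<^sup>2 * M0\<^sup>2) \<le> r0 / (8 * Lb * M0\<^sup>2)"
    by (simp add: mult_ac)
qed

theorem theorem4p6:
  fixes \<Phi> :: "'u::real_normed_vector \<Rightarrow> ('y::banach \<Rightarrow>\<^sub>L real)"
    and f :: "'u \<Rightarrow> real" and g :: "'u \<Rightarrow> ereal" and J :: "'u \<Rightarrow> ereal"
    and grad :: "'u \<Rightarrow> 'y" and N :: "'u set"
    and u :: "nat \<Rightarrow> 'u" and L :: "nat \<Rightarrow> real"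
    and Lf La Lb M0 r0 q1 q2 q :: real
  assumes A1: "separable_space (euclidean :: 'y topology)" "isometric_dual_iso \<Phi>"
    and A2: "\<And>v. 0 \<le> g v" "proper_fun g" "convex_ereal g" "seq_lsc_on (weak_star \<Phi>) UNIV g"
    and A3: "\<And>v. 0 \<le> f v"
      "seq_lsc_on (weak_star \<Phi>) (effective_domain g) (\<lambda>v. ereal (f v))"
      "\<exists>V. open V \<and> effective_domain g \<subseteq> V \<and> V \<subseteq> N"
      "gateaux_differentiable_on f N"
      "\<And>v. v \<in> effective_domain g \<Longrightarrow> has_gateaux_derivative f (\<lambda>d. pairing \<Phi> (grad v) d) v"
      "0 \<le> Lf"
      "\<And>v w. v \<in> effective_domain g \<Longrightarrow> w \<in> effective_domain g
         \<Longrightarrow> norm (grad v - grad w) \<le> Lf * norm (v - w)"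
    and J: "J = objective f g"
    and A4: "\<And>x :: nat \<Rightarrow> 'u. filterlim (\<lambda>k. norm (x k)) at_top sequentially
         \<Longrightarrow> (\<lambda>k. J (x k)) \<longlonglongrightarrow> \<infinity>"
    and f_convex: "convex_on UNIV f"
    and stepsizes: "0 < La" "La \<le> Lb"
    and algorithm: "prox_grad_sequence \<Phi> f grad g La Lb L u"
    and M0: "0 < M0" "\<And>v. J v \<le> J (u 0) \<Longrightarrow> norm v \<le> M0"
    and r0: "r0 = real_of_ereal (residual J (u 0))"
    and q1: "q1 = 1 / 2 * min 1 (r0 / (4 * Lb * M0\<^sup>2))"
    and q2: "q2 = La * r0 / (8 * (Lb + Lf)\<^sup>2 * M0\<^sup>2)"
    and q: "q = max q1 q2"
  shows "(\<forall>k. residual J (u k) \<le> residual J (u 0) / ereal (1 + q * real k)) \<and>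
    (\<exists>\<sigma> l. strict_mono \<sigma> \<and> limitin (weak_star \<Phi>) (u \<circ> \<sigma>) l sequentially) \<and>
    (\<forall>l. seq_accumulation_point (weak_star \<Phi>) u l \<longrightarrow> is_arg_min J (\<lambda>v. v \<in> UNIV) l)"
proof -
  let ?Q = "\<lambda>k v. prox_model \<Phi> f grad g (L k) v (u k)"
  have Lb: "0 < Lb" using stepsizes by simp
  have u0: "u 0 \<in> effective_domain g"
    and argmin: "\<And>k v. ?Q k (u (Suc k)) \<le> ?Q k v"
    and Lk: "\<And>k. La \<le> L k" "\<And>k. L k \<le> Lb"
    and descent: "\<And>k. J (u (Suc k)) \<le> ?Q k (u (Suc k))"
    using algorithm by (auto simp: prox_grad_sequence_def is_arg_min_def not_less J)
  have Q_self: "?Q k (u k) = J (u k)" for k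
    using A1(2) by (simp add: prox_model_def J objective_def pairing_def
        isometric_dual_iso_def linear_0)
  have decreasing: "J (u (Suc k)) \<le> J (u k)" for k
    using order_trans[OF descent argmin[of k "u k"]] Q_self by simp
  have below_start: "J (u k) \<le> J (u 0)" for k
    by (induction k) (auto intro: order_trans[OF decreasing])
  have J_dom: "v \<in> effective_domain g" if "J v \<le> J (u 0)" for v
    using that u0 by (auto simp: J objective_def effective_domain_def)
  have bounded: "norm (u k) \<le> M0" for k using M0(2) below_start by blast
  obtain a0 where "g (u 0) = ereal a0"
    using effective_domain_real[OF A2(1) u0] by blast
  then obtain c where c: "J (u 0) = ereal c" by (simp add: J objective_def)
  have "norm v \<le> M0" if "J v \<le> ereal c" for v using M0(2) that c by simp
  then obtain p where p: "\<And>v. J p \<le> J v"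
    using objective_has_minimizer[OF A1 A2(1) A3(1) A2(4) A3(2), of "u 0" c M0] c
    unfolding J by blast
  have res: "residual J v = J v - J p" for v
    by (rule residual_eq_diff_minimum) (rule p)
  obtain b where b: "g p = ereal b"
    using effective_domain_real[OF A2(1) J_dom[OF p]] by blast
  have "\<exists>a. g (u k) = ereal a" for k
    using effective_domain_real[OF A2(1) J_dom[OF below_start]] by blast
  then obtain a where a: "\<And>k. g (u k) = ereal (a k)" by metis
  define r where "r k = (f (u k) + a k) - (f p + b)" for k
  have J_u: "J (u k) = ereal (f (u k) + a k)" and J_p: "J p = ereal (f p + b)" for k
    using a b by (simp_all add: J objective_def)
  have res_u: "residual J (u k) = ereal (r k)" for k
    by (simp add: res J_u J_p r_def)
  have r_nonneg: "0 \<le> r k" for k using p[of "u k"] by (simp add: J_u J_p r_def)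
  have r0_eq: "r0 = r 0" by (simp add: r0 res_u)
  define C where "C = 4 * Lb * M0\<^sup>2"
  have "0 < C" using Lb M0(1) by (simp add: C_def)
  have "r (Suc k) \<le> (1 - t) * r k + C / 2 * t\<^sup>2" if "0 \<le> t" "t \<le> 1" for k t
  proof -
    have "objective f g (u (Suc k))
        \<le> ereal ((1 - t) * (f (u k) + a k) + t * (f p + b) + 4 * Lb * M0\<^sup>2 / 2 * t\<^sup>2)"
      using prox_grad_residual_step[OF f_convex A2(3) A3(5)[OF J_dom[OF below_start]] a b
          bounded M0(2)[OF p] _ Lk(2) argmin _ that] descent[of k] Lk(1)[of k] stepsizes
      by (simp add: J)
    then show ?thesis using J_u[of "Suc k"] by (simp add: J r_def C_def algebra_simps)
  qed
  then have decay: "r k * (2 * C + k * r 0) \<le> 2 * C * r 0" for k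
    using sublinear_decay[OF \<open>0 < C\<close>, of r k] r_nonneg by blast
  have q_nonneg: "0 \<le> q" using Lb M0(1) stepsizes r_nonneg[of 0] r0_eq
    by (simp add: q q1 le_max_iff_disj)
  have rate: "r k \<le> r 0 / (1 + q * k)" for k
  proof -
    have "q \<le> r 0 / (2 * C)"
      using rate_constants_le[of r0 M0 La Lb Lf] r_nonneg[of 0] M0(1) stepsizes A3(6)
      by (simp add: q q1 q2 r0_eq C_def mult_ac)
    then have "r k * (1 + q * k) \<le> r k * (1 + r 0 / (2 * C) * k)"
      using r_nonneg[of k] by (intro mult_left_mono add_left_mono mult_right_mono) auto
    also have "\<dots> \<le> r 0"
      using decay[of k] \<open>0 < C\<close> by (simp add: field_simps)
    finally show ?thesis using q_nonneg by (simp add: pos_le_divide_eq add_pos_nonneg)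
  qed
  have "residual J (u k) \<le> residual J (u 0) / ereal (1 + q * real k)" for k
  proof -
    have "0 < 1 + q * real k" using q_nonneg by (simp add: add_pos_nonneg)
    then show ?thesis using rate[of k] by (simp add: res_u)
  qed
  moreover have "\<exists>\<sigma> l. strict_mono \<sigma> \<and> limitin (weak_star \<Phi>) (u \<circ> \<sigma>) l sequentially"
    by (rule bounded_sequence_has_weak_star_convergent_subsequence[OF A1, of u M0]) (use bounded in auto)
  moreover have "is_arg_min J (\<lambda>v. v \<in> UNIV) l" if l: "seq_accumulation_point (weak_star \<Phi>) u l" for l
  proof -
    have "r \<longlonglongrightarrow> 0"
      \<comment> \<open>The rate bound has decay constant \<open>r 0 / (2 * C)\<close>, which is useless for \<open>r 0 = 0\<close>; the
        starting point is then already a minimizer.\<close>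
    proof (cases "r 0 = 0")
      case True
      then have "r k = 0" for k using rate[of k] r_nonneg[of k] by simp
      then have "r = (\<lambda>_. 0)" by (intro ext)
      then show ?thesis by simp
    next
      case False
      have "0 < r 0" using False r_nonneg[of 0] by simp
      have bound: "r k \<le> (2 * C) * inverse (real k)" if "0 < k" for k
      proof -
        have "r k * (k * r 0) \<le> r k * (2 * C + k * r 0)"
          using r_nonneg[of k] \<open>0 < C\<close> by (intro mult_left_mono) auto
        then have "(r k * k) * r 0 \<le> (2 * C) * r 0" using decay[of k] by (simp add: mult_ac)
        then have "r k * k \<le> 2 * C" using \<open>0 < r 0\<close> by simp
        then show ?thesis using that by (simp add: field_simps)
      qed
      have "(\<lambda>k. (2 * C) * inverse (real k)) \<longlonglongrightarrow> (2 * C) * 0"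
        by (intro tendsto_mult tendsto_const lim_inverse_n)
      then have null: "(\<lambda>k. (2 * C) * inverse (real k)) \<longlonglongrightarrow> 0" by simp
      show ?thesis
        using r_nonneg bound
        by (intro tendsto_sandwich[OF _ _ tendsto_const null])
          (auto intro: eventually_sequentiallyI[of 1])
    qed
    then have "(\<lambda>k. r k + (f p + b)) \<longlonglongrightarrow> 0 + (f p + b)"
      by (intro tendsto_add tendsto_const)
    then have J_lim: "(\<lambda>k. J (u k)) \<longlonglongrightarrow> J p"
      by (simp add: J_u J_p r_def)
    obtain \<sigma> where \<sigma>: "strict_mono \<sigma>" "limitin (weak_star \<Phi>) (u \<circ> \<sigma>) l sequentially"
      by (rule bounded_sequence_accumulation_point_is_subsequence_limit[OF A1 _ l, of M0]) (use bounded in auto)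
    have "J l \<le> J p"
      unfolding J
    proof (rule objective_limit_le[OF A2(1) A3(1) A2(4) A3(2) _ \<sigma>(2)])
      show "objective f g ((u \<circ> \<sigma>) n) \<le> ereal c" for n
        using below_start[of "\<sigma> n"] c by (simp add: J)
      show "(\<lambda>n. objective f g ((u \<circ> \<sigma>) n)) \<longlonglongrightarrow> objective f g p"
        using LIMSEQ_subseq_LIMSEQ[OF J_lim \<sigma>(1)] by (simp add: J o_def)
    qed
    then have "J l \<le> J v" for v using p by (rule order_trans)
    then show ?thesis by (simp add: is_arg_min_def not_less)
  qed
  ultimately show ?thesis by blast
qed

end
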